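(* The category $\mathcal R_2$ is $\Gamma$-faithful on objects: if $D,E\in\mathcal R_2$ and $\Gamma(D)\cong\Gamma(E)$, then $D\cong E$.
   Context: Directed subsets are nonempty; a dcpo is a poset in which every directed subset has a supremum. $\mathbf{DCPO}$ is the category of dcpos and Scott-continuous maps. For dcpos $A,B$, $[A\to B]$ is the dcpo of Scott-continuous maps ordered pointwise. All full subcategories are closed under isomorphisms. $\Gamma(D)$ is the complete lattice of Scott-closed subsets of $D$ ordered by inclusion; $\cong$ between such lattices means order isomorphism. Let $2=\{0<1\}$. $E_2$ is the class of all Scott-continuous maps $e:A\to B$ between dcpos such that $e^*:[B\to 2]\to[A\to 2]$, $g\mapsto g\circ e$, is an isomorphism of dcpos (equivalently, $e^{-1}$ is an order isomorphism from the lattice of Scott-open sets of $B$ onto that of $A$). $\mathcal R_2=E_2^{\perp}$ is the full subcategory of $\mathbf{DCPO}$ of all dcpos $C$ such that for every $e:A\to B$ in $E_2$ the map $e^*:[B\to C]\to[A\to C]$, $g\mapsto g\circ e$, is an isomorphism of dcpos. (It is the least reflective full subcategory of $\mathbf{DCPO}$ containing $2$.) *)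

theory Defs
  imports "HOL-Algebra.Order" "HOL-Library.FuncSet" "HOL-Library.Equipollence"
begin

definition directed_set :: "('a, 'm) gorder_scheme \<Rightarrow> 'a set \<Rightarrow> bool" where
  "directed_set L S \<longleftrightarrow> S \<subseteq> carrier L \<and> S \<noteq> {} \<and>
     (\<forall>x\<in>S. \<forall>y\<in>S. \<exists>z\<in>S. x \<sqsubseteq>\<^bsub>L\<^esub> z \<and> y \<sqsubseteq>\<^bsub>L\<^esub> z)"

text \<open>The empty poset is a dcpo, since directed sets are nonempty.\<close>

locale dcpo = partial_order +
  assumes directed_sup_exists: "directed_set L S \<Longrightarrow> \<exists>s. is_lub L s S"

definition scott_continuous ::
  "('a, 'm) gorder_scheme \<Rightarrow> ('b, 'n) gorder_scheme \<Rightarrow> ('a \<Rightarrow> 'b) \<Rightarrow> bool" where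
  "scott_continuous A B f \<longleftrightarrow> f \<in> carrier A \<rightarrow> carrier B \<and> isotone A B f \<and>
     (\<forall>S s. directed_set A S \<and> is_lub A s S \<longrightarrow> is_lub B (f s) (f ` S))"

text \<open>Isomorphisms in the category of dcpos and Scott-continuous maps.\<close>

definition dcpo_iso ::
  "('a, 'm) gorder_scheme \<Rightarrow> ('b, 'n) gorder_scheme \<Rightarrow> ('a \<Rightarrow> 'b) \<Rightarrow> bool" where
  "dcpo_iso A B f \<longleftrightarrow> dcpo A \<and> dcpo B \<and> scott_continuous A B f \<and>
     (\<exists>g. scott_continuous B A g \<and>
          (\<forall>x\<in>carrier A. g (f x) = x) \<and> (\<forall>y\<in>carrier B. f (g y) = y))"

definition order_iso ::
  "('a, 'm) gorder_scheme \<Rightarrow> ('b, 'n) gorder_scheme \<Rightarrow> ('a \<Rightarrow> 'b) \<Rightarrow> bool" where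
  "order_iso A B f \<longleftrightarrow> bij_betw f (carrier A) (carrier B) \<and> order_emb A B f"

definition scott_closed :: "('a, 'm) gorder_scheme \<Rightarrow> 'a set \<Rightarrow> bool" where
  "scott_closed L C \<longleftrightarrow> C \<subseteq> carrier L \<and>
     (\<forall>x\<in>carrier L. \<forall>y\<in>C. x \<sqsubseteq>\<^bsub>L\<^esub> y \<longrightarrow> x \<in> C) \<and>
     (\<forall>S s. directed_set L S \<and> S \<subseteq> C \<and> is_lub L s S \<longrightarrow> s \<in> C)"

text \<open>The lattice \<open>\<Gamma>(L)\<close>.\<close>

definition Gam :: "('a, 'm) gorder_scheme \<Rightarrow> 'a set gorder" where
  "Gam L = \<lparr>carrier = {C. scott_closed L C}, eq = (=), le = (\<subseteq>)\<rparr>"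

text \<open>Maps are taken extensional (\<open>undefined\<close> off the carrier), so that equality in the
  function space is equality of functions on \<open>carrier A\<close>.\<close>

definition scott_fun ::
  "('a, 'm) gorder_scheme \<Rightarrow> ('b, 'n) gorder_scheme \<Rightarrow> ('a \<Rightarrow> 'b) gorder" where
  "scott_fun A B =
     \<lparr>carrier = {f \<in> carrier A \<rightarrow>\<^sub>E carrier B. scott_continuous A B f},
      eq = (=),
      le = (\<lambda>f g. \<forall>x\<in>carrier A. f x \<sqsubseteq>\<^bsub>B\<^esub> g x)\<rparr>"

text \<open>The map \<open>e\<^sup>*\<close>; the composite is restricted to \<open>carrier A\<close>.\<close>

definition precomp :: "('a, 'm) gorder_scheme \<Rightarrow> ('a \<Rightarrow> 'b) \<Rightarrow> ('b \<Rightarrow> 'c) \<Rightarrow> ('a \<Rightarrow> 'c)" where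
  "precomp A e = (\<lambda>g. compose (carrier A) g e)"

definition two :: "bool gorder" where
  "two = \<lparr>carrier = UNIV, eq = (=), le = (\<le>)\<rparr>"

definition E2 :: "('a, 'm) gorder_scheme \<Rightarrow> ('b, 'n) gorder_scheme \<Rightarrow> ('a \<Rightarrow> 'b) set" where
  "E2 A B = {e \<in> carrier (scott_fun A B). dcpo A \<and> dcpo B \<and>
               dcpo_iso (scott_fun B two) (scott_fun A two) (precomp A e)}"

text \<open>The objects of \<open>\<R>\<^sub>2 = E\<^sub>2\<^sup>\<bottom>\<close>. HOL cannot quantify over the dcpos of all types at
  once, so the class of test maps is taken relative to a universe, the type \<open>'u\<close>: \<open>A\<close> and
  \<open>B\<close> range over all dcpos carried by subsets of \<open>'u\<close>, that is, up to isomorphism, over all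
  dcpos of cardinality at most that of \<open>'u\<close>.

  As soon as \<open>'u\<close> has at least as many elements as the power set of \<open>carrier C\<close>, this is
  orthogonality to the whole class \<open>E\<^sub>2\<close>. Scott-open sets separate points, so a dcpo \<open>B\<close>
  has no more elements than \<open>[B \<rightarrow> 2]\<close>; hence a map \<open>C \<rightarrow> B\<close> in \<open>E\<^sub>2\<close> forces \<open>B\<close> to have at
  most as many elements as the power set of \<open>carrier C\<close>. In particular the reflection
  \<open>C \<rightarrow> R C\<close> into the full \<open>\<R>\<^sub>2\<close>, which lies in \<open>E\<^sub>2\<close> because \<open>2\<close> belongs to \<open>\<R>\<^sub>2\<close>, has an
  isomorphic copy in \<open>'u\<close>, and orthogonality of \<open>C\<close> to that single map makes it an
  isomorphism. Without a lower bound on \<open>'u\<close> the notion would degenerate.\<close>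

definition R2 :: "'u itself \<Rightarrow> 'c gorder set" where
  "R2 U = {C. dcpo C \<and>
     (\<forall>(A :: 'u gorder) (B :: 'u gorder). \<forall>e\<in>E2 A B.
        dcpo_iso (scott_fun B C) (scott_fun A C) (precomp A e))}"

end

theory Submission
  imports Defs
begin

text \<open>Transport everything along the given isomorphism into one complete lattice
  \<open>P \<cong> \<Gamma>(D) \<cong> \<Gamma>(E)\<close>. Both \<open>D\<close> and \<open>E\<close> embed into \<open>P\<close> as sub-dcpos \<open>X\<close> and \<open>Y\<close>, by their
  principal ideals. Let \<open>B\<close> be the closure of \<open>X \<union> Y\<close> under directed suprema in \<open>P\<close>. Every
  element of \<open>P\<close> is determined by the elements of \<open>X\<close> below it, and likewise for \<open>Y\<close>. It follows
  that a Scott-closed subset of \<open>B\<close> consists of the elements of \<open>B\<close> below some \<open>q \<in> P\<close>, so that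
  the inclusions of \<open>X\<close> and \<open>Y\<close> into \<open>B\<close> both lie in \<open>E\<^sub>2\<close>. Two objects of \<open>\<R>\<^sub>2\<close> with
  \<open>E\<^sub>2\<close>-maps into a common dcpo are isomorphic.\<close>

section \<open>Order isomorphisms\<close>

lemma is_lub_iff:
  assumes "S \<subseteq> carrier L"
  shows "is_lub L s S \<longleftrightarrow> s \<in> carrier L \<and> (\<forall>x\<in>S. x \<sqsubseteq>\<^bsub>L\<^esub> s) \<and>
    (\<forall>u\<in>carrier L. (\<forall>x\<in>S. x \<sqsubseteq>\<^bsub>L\<^esub> u) \<longrightarrow> s \<sqsubseteq>\<^bsub>L\<^esub> u)"
  using assms unfolding least_def Upper_def by blast

lemma dcpo_partial_order: "dcpo L \<Longrightarrow> partial_order L"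
  by (simp add: dcpo_def)

lemma partial_order_weak: "partial_order L \<Longrightarrow> weak_partial_order L"
  by (simp add: partial_order_def)

lemma dcpoI:
  assumes "partial_order L" "\<And>S. directed_set L S \<Longrightarrow> \<exists>s. is_lub L s S"
  shows "dcpo L"
  using assms by (simp add: dcpo_def dcpo_axioms_def)

lemma partial_orderI:
  assumes "eq L = (=)"
    and "\<And>x. x \<in> carrier L \<Longrightarrow> x \<sqsubseteq>\<^bsub>L\<^esub> x"
    and "\<And>x y. \<lbrakk>x \<in> carrier L; y \<in> carrier L; x \<sqsubseteq>\<^bsub>L\<^esub> y; y \<sqsubseteq>\<^bsub>L\<^esub> x\<rbrakk> \<Longrightarrow> x = y"
    and "\<And>x y z. \<lbrakk>x \<in> carrier L; y \<in> carrier L; z \<in> carrier L; x \<sqsubseteq>\<^bsub>L\<^esub> y; y \<sqsubseteq>\<^bsub>L\<^esub> z\<rbrakk>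
      \<Longrightarrow> x \<sqsubseteq>\<^bsub>L\<^esub> z"
  shows "partial_order L"
  by unfold_locales (simp_all add: assms(1-3), metis assms(4))

lemma partial_order_subset:
  assumes "partial_order L" "X \<subseteq> carrier L"
  shows "partial_order (L\<lparr>carrier := X\<rparr>)"
proof -
  interpret partial_order L by fact
  show ?thesis
  proof (rule partial_orderI)
    show "x \<sqsubseteq>\<^bsub>L\<lparr>carrier := X\<rparr>\<^esub> z"
      if "x \<in> carrier (L\<lparr>carrier := X\<rparr>)" "y \<in> carrier (L\<lparr>carrier := X\<rparr>)"
        "z \<in> carrier (L\<lparr>carrier := X\<rparr>)"
        "x \<sqsubseteq>\<^bsub>L\<lparr>carrier := X\<rparr>\<^esub> y" "y \<sqsubseteq>\<^bsub>L\<lparr>carrier := X\<rparr>\<^esub> z" for x y z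
      using that assms(2) le_trans[of x y z] by auto
  qed (use assms(2) eq_is_equal le_antisym in auto)
qed

lemma scott_continuousI:
  assumes "partial_order A" "partial_order B" "f \<in> carrier A \<rightarrow> carrier B"
    and mono: "\<And>x y. \<lbrakk>x \<in> carrier A; y \<in> carrier A; x \<sqsubseteq>\<^bsub>A\<^esub> y\<rbrakk> \<Longrightarrow> f x \<sqsubseteq>\<^bsub>B\<^esub> f y"
    and lub: "\<And>S s u. \<lbrakk>directed_set A S; is_lub A s S; u \<in> carrier B; \<forall>x\<in>S. f x \<sqsubseteq>\<^bsub>B\<^esub> u\<rbrakk>
      \<Longrightarrow> f s \<sqsubseteq>\<^bsub>B\<^esub> u"
  shows "scott_continuous A B f"
  unfolding scott_continuous_def
proof (intro conjI allI impI)
  show "isotone A B f"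
    using assms by (simp add: isotone_def partial_order_weak)
  fix S s
  assume *: "directed_set A S \<and> is_lub A s S"
  then have S: "S \<subseteq> carrier A" by (simp add: directed_set_def)
  then have fS: "f ` S \<subseteq> carrier B" using assms(3) by auto
  have s: "s \<in> carrier A" "\<forall>x\<in>S. x \<sqsubseteq>\<^bsub>A\<^esub> s" using * is_lub_iff[OF S] by auto
  show "is_lub B (f s) (f ` S)"
    unfolding is_lub_iff[OF fS]
  proof (intro conjI ballI impI)
    show "f s \<in> carrier B" using s assms(3) by auto
    show "y \<sqsubseteq>\<^bsub>B\<^esub> f s" if "y \<in> f ` S" for y using that s S mono by auto
    show "f s \<sqsubseteq>\<^bsub>B\<^esub> u" if "u \<in> carrier B" "\<forall>x\<in>f ` S. x \<sqsubseteq>\<^bsub>B\<^esub> u" for u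
      using that * lub[of S s u] by simp
  qed
qed fact

lemma scott_continuousD:
  assumes "scott_continuous A B f"
  shows "x \<in> carrier A \<Longrightarrow> f x \<in> carrier B"
    and "\<lbrakk>x \<in> carrier A; y \<in> carrier A; x \<sqsubseteq>\<^bsub>A\<^esub> y\<rbrakk> \<Longrightarrow> f x \<sqsubseteq>\<^bsub>B\<^esub> f y"
    and "\<lbrakk>directed_set A S; is_lub A s S\<rbrakk> \<Longrightarrow> is_lub B (f s) (f ` S)"
  using assms by (auto simp: scott_continuous_def isotone_def)

lemma scott_continuous_orders:
  assumes "scott_continuous A B f"
  shows "weak_partial_order A" "weak_partial_order B"
  using assms by (auto simp: scott_continuous_def isotone_def)

lemma directed_set_image:
  assumes "directed_set A S" "f \<in> carrier A \<rightarrow> carrier B"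
    and "\<And>x y. \<lbrakk>x \<in> carrier A; y \<in> carrier A; x \<sqsubseteq>\<^bsub>A\<^esub> y\<rbrakk> \<Longrightarrow> f x \<sqsubseteq>\<^bsub>B\<^esub> f y"
  shows "directed_set B (f ` S)"
proof -
  have S: "S \<subseteq> carrier A" "S \<noteq> {}" using assms(1) by (auto simp: directed_set_def)
  have "\<exists>z\<in>S. f x \<sqsubseteq>\<^bsub>B\<^esub> f z \<and> f y \<sqsubseteq>\<^bsub>B\<^esub> f z" if "x \<in> S" "y \<in> S" for x y
  proof -
    obtain z where "z \<in> S" "x \<sqsubseteq>\<^bsub>A\<^esub> z" "y \<sqsubseteq>\<^bsub>A\<^esub> z"
      using assms(1) \<open>x \<in> S\<close> \<open>y \<in> S\<close> unfolding directed_set_def by meson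
    then show ?thesis using assms(3) that S by blast
  qed
  then show ?thesis using S assms(2) by (auto simp: directed_set_def)
qed

lemma scott_continuous_comp:
  assumes f: "scott_continuous A B f" and g: "scott_continuous B C g"
  shows "scott_continuous A C (\<lambda>x. g (f x))"
  unfolding scott_continuous_def
proof (intro conjI allI impI)
  show "isotone A C (\<lambda>x. g (f x))"
    using scott_continuous_orders[OF f] scott_continuous_orders[OF g]
      scott_continuousD[OF f] scott_continuousD[OF g]
    by (simp add: isotone_def)
  show "(\<lambda>x. g (f x)) \<in> carrier A \<rightarrow> carrier C"
    using scott_continuousD[OF f] scott_continuousD[OF g] by auto
  fix S s
  assume *: "directed_set A S \<and> is_lub A s S"
  have "directed_set B (f ` S)"
    by (rule directed_set_image[of A]) (use * scott_continuousD[OF f] in auto)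
  then have "is_lub C (g (f s)) (g ` f ` S)"
    using * scott_continuousD(3)[OF f] scott_continuousD(3)[OF g] by blast
  then show "is_lub C (g (f s)) ((\<lambda>x. g (f x)) ` S)" by (simp add: image_image)
qed

text \<open>Needed to pass between a map and its \<open>restrict\<close>: the elements of
  \<open>scott_fun\<close> are extensional, while composites and inclusions are written as plain
  functions.\<close>

lemma scott_continuous_cong:
  assumes "scott_continuous A B f" "\<And>x. x \<in> carrier A \<Longrightarrow> f x = g x"
  shows "scott_continuous A B g"
  unfolding scott_continuous_def
proof (intro conjI allI impI)
  note f = scott_continuousD[OF assms(1)]
  show "g \<in> carrier A \<rightarrow> carrier B"
    using f(1) assms(2) by auto
  show "isotone A B g"
    using scott_continuous_orders[OF assms(1)] f assms(2)
    by (auto simp: isotone_def)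
  fix S s
  assume *: "directed_set A S \<and> is_lub A s S"
  then have S: "S \<subseteq> carrier A" by (simp add: directed_set_def)
  then have "f ` S = g ` S" "f s = g s"
    using assms(2) * by (auto simp: subset_iff is_lub_iff intro!: image_cong)
  then show "is_lub B (g s) (g ` S)" using * f(3) by metis
qed

section \<open>Order isomorphisms and what they transport\<close>

lemma order_isoD:
  assumes "order_iso A B f"
  shows "x \<in> carrier A \<Longrightarrow> f x \<in> carrier B"
    and "\<lbrakk>x \<in> carrier A; y \<in> carrier A\<rbrakk> \<Longrightarrow> f x \<sqsubseteq>\<^bsub>B\<^esub> f y \<longleftrightarrow> x \<sqsubseteq>\<^bsub>A\<^esub> y"
    and "inj_on f (carrier A)" "f ` carrier A = carrier B"
  using assms by (auto simp: order_iso_def order_emb_def bij_betw_def)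

lemma order_isoI:
  assumes "partial_order A" "partial_order B" "f ` carrier A = carrier B"
    and "\<And>x y. \<lbrakk>x \<in> carrier A; y \<in> carrier A\<rbrakk> \<Longrightarrow> f x \<sqsubseteq>\<^bsub>B\<^esub> f y \<longleftrightarrow> x \<sqsubseteq>\<^bsub>A\<^esub> y"
  shows "order_iso A B f"
proof -
  interpret A: partial_order A by fact
  interpret B: partial_order B by fact
  have "inj_on f (carrier A)"
  proof (rule inj_onI)
    fix x y
    assume xy: "x \<in> carrier A" "y \<in> carrier A" "f x = f y"
    then have "f x \<in> carrier B" using assms(3) by blast
    then have "f x \<sqsubseteq>\<^bsub>B\<^esub> f y" "f y \<sqsubseteq>\<^bsub>B\<^esub> f x" using xy(3) B.le_refl by metis+
    then show "x = y" using assms(4)[of x y] assms(4)[of y x] xy A.le_antisym[of x y] by metis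
  qed
  then show ?thesis
    using assms A.weak_partial_order_axioms B.weak_partial_order_axioms
    by (simp add: order_iso_def order_emb_def bij_betw_def)
qed

lemma order_iso_inv:
  assumes "order_iso A B f"
  shows "order_iso B A (inv_into (carrier A) f)"
proof -
  note f = order_isoD[OF assms]
  let ?g = "inv_into (carrier A) f"
  have g: "?g y \<in> carrier A" "f (?g y) = y" if "y \<in> carrier B" for y
    using that f(4) inv_into_into[of y f "carrier A"] f_inv_into_f[of y f "carrier A"] by simp_all
  have "?g x \<sqsubseteq>\<^bsub>A\<^esub> ?g y \<longleftrightarrow> x \<sqsubseteq>\<^bsub>B\<^esub> y" if "x \<in> carrier B" "y \<in> carrier B" for x y
    using f(2)[of "?g x" "?g y"] g that by simp
  then show ?thesis
    using assms by (auto simp: order_iso_def order_emb_def bij_betw_inv_into)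
qed

lemma order_iso_comp:
  assumes "order_iso A B f" "order_iso B C g"
  shows "order_iso A C (g \<circ> f)"
  using assms bij_betw_trans[of f "carrier A" "carrier B" g "carrier C"]
    order_isoD(1)[OF assms(1)]
  by (auto simp: order_iso_def order_emb_def)

text \<open>By surjectivity every upper bound of the image is the image of an upper bound of
  \<open>S\<close>, so leastness can be tested in \<open>A\<close>.\<close>

lemma order_iso_lub:
  assumes "order_iso A B f" "S \<subseteq> carrier A" "is_lub A s S"
  shows "is_lub B (f s) (f ` S)"
proof -
  note f = order_isoD[OF assms(1)]
  have fS: "f ` S \<subseteq> carrier B" using f(1) assms(2) by auto
  have s: "s \<in> carrier A" "\<forall>x\<in>S. x \<sqsubseteq>\<^bsub>A\<^esub> s"
    "\<forall>u\<in>carrier A. (\<forall>x\<in>S. x \<sqsubseteq>\<^bsub>A\<^esub> u) \<longrightarrow> s \<sqsubseteq>\<^bsub>A\<^esub> u"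
    using assms(3) unfolding is_lub_iff[OF assms(2)] by blast+
  have "f s \<sqsubseteq>\<^bsub>B\<^esub> v" if v: "v \<in> carrier B" "\<forall>x\<in>S. f x \<sqsubseteq>\<^bsub>B\<^esub> v" for v
  proof -
    obtain u where u: "u \<in> carrier A" "v = f u" using v(1) unfolding f(4)[symmetric] by blast
    then have "\<forall>x\<in>S. x \<sqsubseteq>\<^bsub>A\<^esub> u" using v(2) u(2) f(2)[OF _ u(1)] assms(2) by (metis subsetD)
    then show ?thesis using u s f(2)[of s u] by simp
  qed
  moreover have "f x \<sqsubseteq>\<^bsub>B\<^esub> f s" if "x \<in> S" for x
    using that s assms(2) f(2)[of x s] by auto
  ultimately show ?thesis
    unfolding is_lub_iff[OF fS] using f(1)[OF s(1)] by simp
qed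

lemma order_iso_scott_continuous:
  assumes "order_iso A B f" "partial_order A" "partial_order B"
  shows "scott_continuous A B f"
proof -
  note f = order_isoD[OF assms(1)]
  show ?thesis
    unfolding scott_continuous_def isotone_def
    using f(1,2) partial_order_weak[OF assms(2)] partial_order_weak[OF assms(3)]
      order_iso_lub[OF assms(1)]
    by (auto simp: directed_set_def)
qed

lemma order_iso_directed_set:
  assumes "order_iso A B f" "directed_set A S"
  shows "directed_set B (f ` S)"
  by (rule directed_set_image[OF assms(2)]) (use order_isoD[OF assms(1)] in auto)

lemma order_iso_dcpo:
  assumes "order_iso A B f" "dcpo A" "partial_order B"
  shows "dcpo B"
proof (rule dcpoI[OF assms(3)])
  fix S
  assume S: "directed_set B S"
  let ?g = "inv_into (carrier A) f"
  have "directed_set A (?g ` S)"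
    using order_iso_directed_set[OF order_iso_inv[OF assms(1)] S] .
  moreover from this obtain s where "is_lub A s (?g ` S)"
    using dcpo.directed_sup_exists[OF assms(2)] by blast
  ultimately have "is_lub B (f s) (f ` ?g ` S)"
    using order_iso_lub[OF assms(1)] by (simp add: directed_set_def)
  moreover have "f ` ?g ` S = S"
    using S order_isoD(4)[OF assms(1)] by (simp add: directed_set_def image_inv_into_cancel)
  ultimately show "\<exists>s. is_lub B s S" by auto
qed

lemma order_iso_dcpo_iso:
  assumes "order_iso A B f" "dcpo A" "dcpo B"
  shows "dcpo_iso A B f"
  unfolding dcpo_iso_def
proof (intro conjI exI ballI)
  note f = order_isoD[OF assms(1)]
  show "scott_continuous A B f"
    by (intro order_iso_scott_continuous dcpo_partial_order assms)
  show "scott_continuous B A (inv_into (carrier A) f)"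
    by (intro order_iso_scott_continuous order_iso_inv dcpo_partial_order assms)
  show "inv_into (carrier A) f (f x) = x" if "x \<in> carrier A" for x
    using that f(3) by simp
  show "f (inv_into (carrier A) f y) = y" if "y \<in> carrier B" for y
    using that f(4) by (simp add: f_inv_into_f)
qed (use assms in auto)

section \<open>Closure properties of Scott-closed sets\<close>

lemma scott_closedD:
  assumes "scott_closed L C"
  shows "C \<subseteq> carrier L"
    and "\<lbrakk>x \<in> carrier L; y \<in> C; x \<sqsubseteq>\<^bsub>L\<^esub> y\<rbrakk> \<Longrightarrow> x \<in> C"
    and "\<lbrakk>directed_set L S; S \<subseteq> C; is_lub L s S\<rbrakk> \<Longrightarrow> s \<in> C"
  using assms by (auto simp: scott_closed_def)

lemma scott_closed_vimage:
  assumes f: "scott_continuous A B f" and C: "scott_closed B C"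
  shows "scott_closed A {x \<in> carrier A. f x \<in> C}"
  unfolding scott_closed_def
proof (intro conjI ballI allI impI)
  note f = scott_continuousD[OF f] and C = scott_closedD[OF C]
  fix S s
  assume *: "directed_set A S \<and> S \<subseteq> {x \<in> carrier A. f x \<in> C} \<and> is_lub A s S"
  have "directed_set B (f ` S)"
    by (rule directed_set_image[of A]) (use * f in auto)
  moreover have "is_lub B (f s) (f ` S)" using * f(3) by blast
  ultimately have "f s \<in> C" using C(3) * by blast
  moreover have "s \<in> carrier A" using * by blast
  ultimately show "s \<in> {x \<in> carrier A. f x \<in> C}" by simp
next
  fix x y
  assume "x \<in> carrier A" "y \<in> {x \<in> carrier A. f x \<in> C}" "x \<sqsubseteq>\<^bsub>A\<^esub> y"
  then show "x \<in> {x \<in> carrier A. f x \<in> C}"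
    using scott_continuousD[OF f] scott_closedD[OF C] by blast
qed auto

text \<open>The intersection is taken inside \<open>carrier L\<close>, so that the empty family
  yields the whole carrier.\<close>

lemma scott_closed_INT:
  assumes "\<And>i. i \<in> I \<Longrightarrow> scott_closed L (C i)"
  shows "scott_closed L {x \<in> carrier L. \<forall>i\<in>I. x \<in> C i}"
  unfolding scott_closed_def
proof (intro conjI ballI allI impI)
  note C = scott_closedD[OF assms]
  show "x \<in> {x \<in> carrier L. \<forall>i\<in>I. x \<in> C i}"
    if "x \<in> carrier L" "y \<in> {x \<in> carrier L. \<forall>i\<in>I. x \<in> C i}" "x \<sqsubseteq>\<^bsub>L\<^esub> y" for x y
    using that C(2)[of _ x y] by simp
  show "s \<in> {x \<in> carrier L. \<forall>i\<in>I. x \<in> C i}"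
    if *: "directed_set L S \<and> S \<subseteq> {x \<in> carrier L. \<forall>i\<in>I. x \<in> C i} \<and> is_lub L s S" for S s
  proof -
    have "s \<in> C i" if "i \<in> I" for i
    proof (rule C(3))
      show "S \<subseteq> C i" using * that by auto
    qed (use * that in auto)
    then show ?thesis using * by auto
  qed
qed auto

lemma scott_closed_principal:
  assumes "partial_order L" "q \<in> carrier L"
  shows "scott_closed L {x \<in> carrier L. x \<sqsubseteq>\<^bsub>L\<^esub> q}"
  unfolding scott_closed_def
proof (intro conjI ballI allI impI)
  interpret partial_order L by fact
  show "x \<in> {x \<in> carrier L. x \<sqsubseteq>\<^bsub>L\<^esub> q}"
    if "x \<in> carrier L" "y \<in> {x \<in> carrier L. x \<sqsubseteq>\<^bsub>L\<^esub> q}" "x \<sqsubseteq>\<^bsub>L\<^esub> y" for x y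
    using that assms(2) le_trans by blast
  show "s \<in> {x \<in> carrier L. x \<sqsubseteq>\<^bsub>L\<^esub> q}"
    if "directed_set L S \<and> S \<subseteq> {x \<in> carrier L. x \<sqsubseteq>\<^bsub>L\<^esub> q} \<and> is_lub L s S" for S s
  proof -
    have "S \<subseteq> carrier L" "\<forall>x\<in>S. x \<sqsubseteq>\<^bsub>L\<^esub> q" using that by auto
    then show ?thesis using that is_lub_iff[of S L s] assms(2) by simp
  qed
qed auto

section \<open>Scott-closed sets and maps into \<open>2\<close>\<close>

lemma partial_order_scott_fun:
  assumes "partial_order B"
  shows "partial_order (scott_fun A B)"
proof (rule partial_orderI)
  interpret B: partial_order B by fact
  show "f = g" if "f \<in> carrier (scott_fun A B)" "g \<in> carrier (scott_fun A B)"
    "f \<sqsubseteq>\<^bsub>scott_fun A B\<^esub> g" "g \<sqsubseteq>\<^bsub>scott_fun A B\<^esub> f" for f g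
  proof (rule PiE_ext)
    show fg: "f \<in> carrier A \<rightarrow>\<^sub>E carrier B" "g \<in> carrier A \<rightarrow>\<^sub>E carrier B"
      using that by (simp_all add: scott_fun_def)
    show "f x = g x" if "x \<in> carrier A" for x
      using PiE_mem[OF fg(1) that] PiE_mem[OF fg(2) that] that \<open>f \<sqsubseteq>\<^bsub>scott_fun A B\<^esub> g\<close>
        \<open>g \<sqsubseteq>\<^bsub>scott_fun A B\<^esub> f\<close> B.le_antisym[of "f x" "g x"]
      by (simp add: scott_fun_def)
  qed
  show "f \<sqsubseteq>\<^bsub>scott_fun A B\<^esub> h" if "f \<in> carrier (scott_fun A B)" "g \<in> carrier (scott_fun A B)"
    "h \<in> carrier (scott_fun A B)" "f \<sqsubseteq>\<^bsub>scott_fun A B\<^esub> g" "g \<sqsubseteq>\<^bsub>scott_fun A B\<^esub> h" for f g h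
    using that by (simp add: scott_fun_def) (meson B.le_trans PiE_mem)
qed (auto simp: scott_fun_def PiE_mem intro!: weak_partial_order.le_refl[OF partial_order_weak[OF assms]])

lemma partial_order_two: "partial_order two"
  by (rule partial_orderI) (auto simp: two_def)

text \<open>Maps into \<open>two\<close> are encoded by the set where they are \<open>False\<close>,
  because \<open>Gam\<close> speaks of closed rather than open sets.\<close>

lemma scott_continuous_two_iff:
  assumes "partial_order A"
  shows "scott_continuous A two f \<longleftrightarrow> scott_closed A {x \<in> carrier A. \<not> f x}"
proof
  assume "scott_continuous A two f"
  \<comment> \<open>\<open>{False}\<close> is a principal ideal of \<open>two\<close>, hence
    Scott-closed, and the zero set is its preimage.\<close>
  moreover have "{x \<in> carrier two. x \<sqsubseteq>\<^bsub>two\<^esub> False} = {False}" by (auto simp: two_def)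
  then have "scott_closed two {False}"
    using scott_closed_principal[OF partial_order_two, of False] by (simp add: two_def)
  ultimately show "scott_closed A {x \<in> carrier A. \<not> f x}"
    using scott_closed_vimage[of A two f "{False}"] by simp
next
  assume C: "scott_closed A {x \<in> carrier A. \<not> f x}"
  show "scott_continuous A two f"
  proof (rule scott_continuousI[OF assms partial_order_two])
    show "f x \<sqsubseteq>\<^bsub>two\<^esub> f y" if "x \<in> carrier A" "y \<in> carrier A" "x \<sqsubseteq>\<^bsub>A\<^esub> y" for x y
      using scott_closedD(2)[OF C, of x y] that by (auto simp: two_def)
    show "f s \<sqsubseteq>\<^bsub>two\<^esub> u" if "directed_set A S" "is_lub A s S" "\<forall>x\<in>S. f x \<sqsubseteq>\<^bsub>two\<^esub> u" for S s u
      using scott_closedD(3)[OF C, of S s] that by (auto simp: two_def directed_set_def)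
  qed (auto simp: two_def)
qed

lemma scott_fun_two_eq:
  assumes "partial_order A"
  shows "carrier (scott_fun A two) =
      {f \<in> extensional (carrier A). scott_closed A {x \<in> carrier A. \<not> f x}}"
    and "f \<sqsubseteq>\<^bsub>scott_fun A two\<^esub> g \<longleftrightarrow> (\<forall>x\<in>carrier A. f x \<longrightarrow> g x)"
proof -
  have [simp]: "carrier two = UNIV" "le two = (\<le>)" by (simp_all add: two_def)
  show "carrier (scott_fun A two) =
      {f \<in> extensional (carrier A). scott_closed A {x \<in> carrier A. \<not> f x}}"
    by (auto simp: scott_fun_def scott_continuous_two_iff[OF assms] PiE_def)
  show "f \<sqsubseteq>\<^bsub>scott_fun A two\<^esub> g \<longleftrightarrow> (\<forall>x\<in>carrier A. f x \<longrightarrow> g x)"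
    by (simp add: scott_fun_def le_bool_def)
qed

text \<open>In terms of zero sets the pointwise order is reverse inclusion. The supremum of
  \<open>S\<close> is therefore the map whose zero set is the intersection \<open>V\<close> of the
  zero sets of the members of \<open>S\<close>.\<close>

lemma dcpo_scott_fun_two:
  assumes "partial_order A"
  shows "dcpo (scott_fun A two)"
proof (rule dcpoI)
  show "partial_order (scott_fun A two)" by (rule partial_order_scott_fun[OF partial_order_two])
  fix S
  assume S: "directed_set (scott_fun A two) S"
  then have Sc: "S \<subseteq> carrier (scott_fun A two)" by (simp add: directed_set_def)
  define Z where "Z f = {x \<in> carrier A. \<not> f x}" for f
  have Z: "f \<in> carrier (scott_fun A two) \<longleftrightarrow> f \<in> extensional (carrier A) \<and> scott_closed A (Z f)"
    "f \<sqsubseteq>\<^bsub>scott_fun A two\<^esub> g \<longleftrightarrow> Z g \<subseteq> Z f" for f g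
    unfolding scott_fun_two_eq[OF assms] Z_def by blast+
  define V where "V = {x \<in> carrier A. \<forall>f\<in>S. x \<in> Z f}"
  define s where "s = (\<lambda>x\<in>carrier A. x \<notin> V)"
  have "V \<subseteq> carrier A" unfolding V_def by blast
  then have "Z s = V" unfolding Z_def s_def by auto
  moreover have "scott_closed A V"
    unfolding V_def by (rule scott_closed_INT) (use Sc Z(1) in blast)
  ultimately have "s \<in> carrier (scott_fun A two)"
    by (simp add: Z(1)) (simp add: s_def)
  moreover have "V \<subseteq> Z f" if "f \<in> S" for f
    using that unfolding V_def by blast
  moreover have "Z u \<subseteq> V" if "\<forall>f\<in>S. Z u \<subseteq> Z f" for u
  proof -
    have "Z u \<subseteq> carrier A" unfolding Z_def by blast
    then show ?thesis using that unfolding V_def by blast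
  qed
  ultimately have "is_lub (scott_fun A two) s S"
    unfolding is_lub_iff[OF Sc] Z(2) \<open>Z s = V\<close> by blast
  then show "\<exists>s. is_lub (scott_fun A two) s S" by blast
qed

text \<open>On zero sets, \<open>precomp A e\<close> is the preimage operation on Scott-closed sets.
  \<open>surj\<close> makes it onto; \<open>emb\<close> makes it reflect the order, which also gives
  injectivity. An order isomorphism of dcpos is automatically Scott-continuous in both
  directions.\<close>

lemma E2_I:
  assumes A: "dcpo A" and B: "dcpo B" and e: "e \<in> carrier (scott_fun A B)"
    and surj: "\<And>C. scott_closed A C \<Longrightarrow> \<exists>V. scott_closed B V \<and> C = {x \<in> carrier A. e x \<in> V}"
    and emb: "\<And>V W. \<lbrakk>scott_closed B V; scott_closed B W;
      \<And>x. \<lbrakk>x \<in> carrier A; e x \<in> V\<rbrakk> \<Longrightarrow> e x \<in> W\<rbrakk> \<Longrightarrow> V \<subseteq> W"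
  shows "e \<in> E2 A B"
proof -
  have pA: "partial_order A" and pB: "partial_order B" using A B dcpo_partial_order by auto
  note two_A = scott_fun_two_eq[OF pA] and two_B = scott_fun_two_eq[OF pB]
  have e': "scott_continuous A B e" "\<And>x. x \<in> carrier A \<Longrightarrow> e x \<in> carrier B"
    using e by (auto simp: scott_fun_def)
  have pre: "precomp A e g \<in> carrier (scott_fun A two)" if "g \<in> carrier (scott_fun B two)" for g
  proof -
    have "scott_closed B {x \<in> carrier B. \<not> g x}" using that two_B by auto
    then have "scott_closed A {x \<in> carrier A. e x \<in> {x \<in> carrier B. \<not> g x}}"
      by (rule scott_closed_vimage[OF e'(1)])
    also have "{x \<in> carrier A. e x \<in> {x \<in> carrier B. \<not> g x}} =
        {x \<in> carrier A. \<not> precomp A e g x}"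
      using e'(2) by (auto simp: precomp_def compose_def)
    finally show ?thesis by (simp add: two_A precomp_def compose_def)
  qed
  have "order_iso (scott_fun B two) (scott_fun A two) (precomp A e)"
  proof (rule order_isoI)
    show "partial_order (scott_fun B two)" "partial_order (scott_fun A two)"
      by (simp_all add: partial_order_scott_fun partial_order_two)
    show "precomp A e ` carrier (scott_fun B two) = carrier (scott_fun A two)"
    proof (intro subset_antisym subsetI)
      fix h
      assume h: "h \<in> carrier (scott_fun A two)"
      then obtain V where V: "scott_closed B V"
        and hV: "{x \<in> carrier A. \<not> h x} = {x \<in> carrier A. e x \<in> V}"
        using surj[of "{x \<in> carrier A. \<not> h x}"] two_A by auto
      \<comment> \<open>The indicator of the complement of \<open>V\<close> has exactly
        \<open>V\<close> as its zero set.\<close>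
      define g where "g = (\<lambda>y\<in>carrier B. y \<notin> V)"
      have "{y \<in> carrier B. \<not> g y} = V"
        using scott_closedD(1)[OF V] by (auto simp: g_def)
      then have "g \<in> carrier (scott_fun B two)"
        using V by (simp add: two_B) (simp add: g_def)
      moreover have "precomp A e g = h"
      proof (rule extensionalityI)
        show "h \<in> extensional (carrier A)" using h two_A by auto
        show "precomp A e g x = h x" if "x \<in> carrier A" for x
          using that hV e'(2)[OF that] by (auto simp: precomp_def compose_def g_def)
      qed (simp add: precomp_def)
      ultimately show "h \<in> precomp A e ` carrier (scott_fun B two)" by blast
    qed (use pre in auto)
    fix g g'
    assume g: "g \<in> carrier (scott_fun B two)" "g' \<in> carrier (scott_fun B two)"
    have "(\<forall>x\<in>carrier B. g x \<longrightarrow> g' x) \<longleftrightarrow> (\<forall>x\<in>carrier A. g (e x) \<longrightarrow> g' (e x))"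
    proof
      assume "\<forall>x\<in>carrier A. g (e x) \<longrightarrow> g' (e x)"
      \<comment> \<open>The order reverses on zero sets, so \<open>emb\<close> is applied with the
        zero set of \<open>g'\<close> on the left.\<close>
      then have "{x \<in> carrier B. \<not> g' x} \<subseteq> {x \<in> carrier B. \<not> g x}"
        using g two_B by (intro emb) auto
      then show "\<forall>x\<in>carrier B. g x \<longrightarrow> g' x" by blast
    qed (use e'(2) in blast)
    then show "precomp A e g \<sqsubseteq>\<^bsub>scott_fun A two\<^esub> precomp A e g' \<longleftrightarrow>
        g \<sqsubseteq>\<^bsub>scott_fun B two\<^esub> g'"
      by (simp add: two_A two_B precomp_def compose_def)
  qed
  then have "dcpo_iso (scott_fun B two) (scott_fun A two) (precomp A e)"
    by (simp add: order_iso_dcpo_iso dcpo_scott_fun_two pA pB)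
  then show ?thesis using A B e by (simp add: E2_def)
qed

section \<open>Objects of \<open>\<R>\<^sub>2\<close> with a common target\<close>

lemma dcpo_iso_imp_bij_betw:
  assumes "dcpo_iso A B f"
  shows "bij_betw f (carrier A) (carrier B)"
proof -
  obtain g where "scott_continuous A B f" "scott_continuous B A g"
    "\<forall>x\<in>carrier A. g (f x) = x" "\<forall>y\<in>carrier B. f (g y) = y"
    using assms by (auto simp: dcpo_iso_def)
  then show ?thesis
    by (intro bij_betw_byWitness[of _ g]) (auto dest: scott_continuousD(1))
qed

text \<open>This is surjectivity of \<open>precomp A e\<close>, applied to \<open>h\<close> after
  restriction to the carrier.\<close>

lemma R2_extension:
  fixes A B :: "'u gorder"
  assumes "C \<in> R2 TYPE('u)" "e \<in> E2 A B" "scott_continuous A C h"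
  obtains r where "scott_continuous B C r" "\<And>x. x \<in> carrier A \<Longrightarrow> r (e x) = h x"
proof -
  have "bij_betw (precomp A e) (carrier (scott_fun B C)) (carrier (scott_fun A C))"
    using assms(1,2) by (intro dcpo_iso_imp_bij_betw) (auto simp: R2_def)
  moreover have "restrict h (carrier A) \<in> carrier (scott_fun A C)"
    using assms(3) scott_continuousD(1)[OF assms(3)]
    by (auto simp: scott_fun_def intro: scott_continuous_cong)
  ultimately obtain r where r: "r \<in> carrier (scott_fun B C)"
    "precomp A e r = restrict h (carrier A)"
    by (metis bij_betw_imp_surj_on imageE)
  then have "r (e x) = h x" if "x \<in> carrier A" for x
    using that fun_cong[OF r(2)[unfolded precomp_def compose_def], of x] by simp
  then show ?thesis using that r(1) by (auto simp: scott_fun_def)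
qed

text \<open>This is injectivity of \<open>precomp A e\<close>, applied to the restrictions of both
  maps.\<close>

lemma R2_unique:
  fixes A B :: "'u gorder"
  assumes "C \<in> R2 TYPE('u)" "e \<in> E2 A B" "scott_continuous B C r" "scott_continuous B C r'"
    and eq: "\<And>x. x \<in> carrier A \<Longrightarrow> r (e x) = r' (e x)" and "y \<in> carrier B"
  shows "r y = r' y"
proof -
  have "inj_on (precomp A e) (carrier (scott_fun B C))"
    using assms(1,2) by (intro bij_betw_imp_inj_on[OF dcpo_iso_imp_bij_betw]) (auto simp: R2_def)
  moreover have "restrict f (carrier B) \<in> carrier (scott_fun B C)"
    if "scott_continuous B C f" for f
    using that scott_continuousD(1)[OF that]
    by (auto simp: scott_fun_def intro: scott_continuous_cong)
  moreover have "e x \<in> carrier B" if "x \<in> carrier A" for x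
    using assms(2) that by (auto simp: E2_def scott_fun_def)
  then have "precomp A e (restrict r (carrier B)) = precomp A e (restrict r' (carrier B))"
    using eq by (auto simp: precomp_def compose_def)
  ultimately have "restrict r (carrier B) = restrict r' (carrier B)"
    using assms(3,4) by (meson inj_onD)
  then show ?thesis using assms(6) by (metis restrict_apply')
qed

text \<open>If \<open>r\<close> and \<open>s\<close> extend the identities of \<open>D\<close> and \<open>E\<close> to \<open>B\<close>, then \<open>r \<circ> e' \<circ> s\<close> and \<open>r\<close>
  agree after composition with \<open>e'\<close>, hence they are equal.\<close>

lemma R2_common_target_inverse:
  fixes A A' B :: "'u gorder"
  assumes D: "D \<in> R2 TYPE('u)"
    and e: "e \<in> E2 A B" and e': "e' \<in> E2 A' B"
    and h: "scott_continuous D A h" and k: "scott_continuous E A' k"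
    and k': "scott_continuous A' E k'" "\<And>x. x \<in> carrier A' \<Longrightarrow> k (k' x) = x"
    and r: "scott_continuous B D r" "\<And>x. x \<in> carrier D \<Longrightarrow> r (e (h x)) = x"
    and s: "scott_continuous B E s" "\<And>x. x \<in> carrier A' \<Longrightarrow> s (e' x) = k' x"
    and d: "d \<in> carrier D"
  shows "r (e' (k (s (e (h d))))) = d"
proof -
  have e'c: "scott_continuous A' B e'" using e' by (simp add: E2_def scott_fun_def)
  have "r (e' (k (s (e (h d))))) = r (e (h d))"
  proof (rule R2_unique[OF D e', where r = "\<lambda>y. r (e' (k (s y)))"])
    show "scott_continuous B D (\<lambda>y. r (e' (k (s y))))"
      using scott_continuous_comp[OF scott_continuous_comp[OF scott_continuous_comp[OF s(1) k] e'c] r(1)] .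
    show "e (h d) \<in> carrier B"
      using e d scott_continuousD(1)[OF h] by (auto simp: E2_def scott_fun_def)
    show "r (e' (k (s (e' x)))) = r (e' x)" if "x \<in> carrier A'" for x
      using that s(2) k'(2) by simp
  qed fact
  then show ?thesis using r(2) d by simp
qed

text \<open>\<open>D\<close> and \<open>E\<close> have their own types, whereas the test maps of
  \<open>R2\<close> live in \<open>'u\<close>; the copies \<open>A\<close> and \<open>A'\<close>
  bridge this. The isomorphism goes from \<open>D\<close> through \<open>A\<close> into
  \<open>B\<close> and back along an extension \<open>s\<close> of \<open>A' \<cong> E\<close>; its
  inverse is built symmetrically.\<close>

lemma R2_iso_if_common_target:
  fixes A A' B :: "'u gorder"
  assumes D: "D \<in> R2 TYPE('u)" and E: "E \<in> R2 TYPE('u)"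
    and e: "e \<in> E2 A B" and e': "e' \<in> E2 A' B"
    and iD: "dcpo_iso D A h" and iE: "dcpo_iso E A' k"
  shows "\<exists>f. dcpo_iso D E f"
proof -
  obtain h' where h: "scott_continuous D A h" "scott_continuous A D h'"
    "\<And>x. x \<in> carrier D \<Longrightarrow> h' (h x) = x" "\<And>x. x \<in> carrier A \<Longrightarrow> h (h' x) = x"
    using iD by (auto simp: dcpo_iso_def)
  obtain k' where k: "scott_continuous E A' k" "scott_continuous A' E k'"
    "\<And>x. x \<in> carrier E \<Longrightarrow> k' (k x) = x" "\<And>x. x \<in> carrier A' \<Longrightarrow> k (k' x) = x"
    using iE by (auto simp: dcpo_iso_def)
  \<comment> \<open>Extending \<open>h'\<close> along \<open>e\<close> makes \<open>r\<close> a
    retraction of \<open>e \<circ> h\<close>; likewise \<open>s\<close> for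
    \<open>e' \<circ> k\<close>.\<close>
  obtain r where r: "scott_continuous B D r" "\<And>x. x \<in> carrier A \<Longrightarrow> r (e x) = h' x"
    using R2_extension[OF D e h(2)] by blast
  obtain s where s: "scott_continuous B E s" "\<And>x. x \<in> carrier A' \<Longrightarrow> s (e' x) = k' x"
    using R2_extension[OF E e' k(2)] by blast
  have ec: "scott_continuous A B e" "scott_continuous A' B e'"
    using e e' by (auto simp: E2_def scott_fun_def)
  have rD: "r (e (h x)) = x" if "x \<in> carrier D" for x
    using that r(2) h(3) scott_continuousD(1)[OF h(1)] by simp
  have sE: "s (e' (k x)) = x" if "x \<in> carrier E" for x
    using that s(2) k(3) scott_continuousD(1)[OF k(1)] by simp
  have "dcpo_iso D E (\<lambda>d. s (e (h d)))"
    unfolding dcpo_iso_def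
  proof (intro conjI exI ballI)
    show "dcpo D" "dcpo E" using D E by (auto simp: R2_def)
    show "scott_continuous D E (\<lambda>d. s (e (h d)))"
      using scott_continuous_comp[OF scott_continuous_comp[OF h(1) ec(1)] s(1)] .
    show "scott_continuous E D (\<lambda>x. r (e' (k x)))"
      using scott_continuous_comp[OF scott_continuous_comp[OF k(1) ec(2)] r(1)] .
    show "r (e' (k (s (e (h d))))) = d" if "d \<in> carrier D" for d
      using R2_common_target_inverse[OF D e e' h(1) k(1,2,4) r(1) rD s that] .
    \<comment> \<open>The preceding lemma with the roles of \<open>D\<close> and \<open>E\<close>
      exchanged.\<close>
    show "s (e (h (r (e' (k x))))) = x" if "x \<in> carrier E" for x
      using R2_common_target_inverse[OF E e' e k(1) h(1,2,4) s(1) sE r that] .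
  qed
  then show ?thesis by blast
qed

section \<open>Dcpos inside their lattice of Scott-closed sets\<close>

lemma directed_set_subset_iff:
  assumes "B \<subseteq> carrier P"
  shows "directed_set (P\<lparr>carrier := B\<rparr>) S \<longleftrightarrow> S \<subseteq> B \<and> directed_set P S"
  using assms unfolding directed_set_def by auto

lemma is_lub_subset:
  assumes "B \<subseteq> carrier P" "S \<subseteq> B" "s \<in> B" "is_lub P s S"
  shows "is_lub (P\<lparr>carrier := B\<rparr>) s S"
proof -
  have S: "S \<subseteq> carrier P" "S \<subseteq> carrier (P\<lparr>carrier := B\<rparr>)" using assms(1,2) by auto
  show ?thesis
    using assms(4) unfolding is_lub_iff[OF S(1)] is_lub_iff[OF S(2)]
    using assms(1,3) by (simp add: subset_iff)
qed

definition directed_closed :: "('a, 'm) gorder_scheme \<Rightarrow> 'a set \<Rightarrow> bool" where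
  "directed_closed P B \<longleftrightarrow> B \<subseteq> carrier P \<and>
    (\<forall>S s. S \<subseteq> B \<and> directed_set P S \<and> is_lub P s S \<longrightarrow> s \<in> B)"

text \<open>The supremum \<open>t\<close> taken in \<open>P\<close> lies in \<open>B\<close>, hence
  is also the supremum in \<open>B\<close>, and suprema are unique.\<close>

lemma is_lub_directed_closed:
  assumes P: "dcpo P" and B: "directed_closed P B"
    and S: "directed_set (P\<lparr>carrier := B\<rparr>) S" and s: "is_lub (P\<lparr>carrier := B\<rparr>) s S"
  shows "is_lub P s S"
proof -
  have BP: "B \<subseteq> carrier P" using B by (simp add: directed_closed_def)
  have SP: "S \<subseteq> B" "directed_set P S" using S directed_set_subset_iff[OF BP] by auto
  obtain t where t: "is_lub P t S" using dcpo.directed_sup_exists[OF P SP(2)] by blast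
  then have "t \<in> B" using B SP unfolding directed_closed_def by blast
  then have "is_lub (P\<lparr>carrier := B\<rparr>) t S" using is_lub_subset[OF BP SP(1) _ t] by simp
  then have "s = t"
    using partial_order.least_unique[OF partial_order_subset[OF dcpo_partial_order[OF P] BP] s]
    by simp
  then show ?thesis using t by simp
qed

lemma dcpo_directed_closed:
  assumes P: "dcpo P" and B: "directed_closed P B"
  shows "dcpo (P\<lparr>carrier := B\<rparr>)"
proof (rule dcpoI)
  have BP: "B \<subseteq> carrier P" using B by (simp add: directed_closed_def)
  show "partial_order (P\<lparr>carrier := B\<rparr>)"
    by (rule partial_order_subset[OF dcpo_partial_order[OF P] BP])
  fix S
  assume "directed_set (P\<lparr>carrier := B\<rparr>) S"
  then have SP: "S \<subseteq> B" "directed_set P S" using directed_set_subset_iff[OF BP] by auto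
  obtain t where t: "is_lub P t S" using dcpo.directed_sup_exists[OF P SP(2)] by blast
  then have "t \<in> B" using B SP unfolding directed_closed_def by blast
  then show "\<exists>t. is_lub (P\<lparr>carrier := B\<rparr>) t S" using is_lub_subset[OF BP SP(1) _ t] by blast
qed

text \<open>Directed suprema in \<open>B\<close> are suprema in \<open>P\<close>, so they stay below
  the bound \<open>q\<close>, whether or not \<open>q\<close> itself lies in
  \<open>B\<close>.\<close>

lemma scott_closed_trace:
  assumes P: "dcpo P" and B: "directed_closed P B" and q: "q \<in> carrier P"
  shows "scott_closed (P\<lparr>carrier := B\<rparr>) {x \<in> B. x \<sqsubseteq>\<^bsub>P\<^esub> q}"
  unfolding scott_closed_def
proof (intro conjI ballI allI impI)
  interpret P: partial_order P by (rule dcpo_partial_order[OF P])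
  have BP: "B \<subseteq> carrier P" using B by (simp add: directed_closed_def)
  show "x \<in> {x \<in> B. x \<sqsubseteq>\<^bsub>P\<^esub> q}"
    if "x \<in> carrier (P\<lparr>carrier := B\<rparr>)" "y \<in> {x \<in> B. x \<sqsubseteq>\<^bsub>P\<^esub> q}"
      "x \<sqsubseteq>\<^bsub>P\<lparr>carrier := B\<rparr>\<^esub> y" for x y
    using that q BP P.le_trans[of x y q] by (simp add: subset_iff)
  show "s \<in> {x \<in> B. x \<sqsubseteq>\<^bsub>P\<^esub> q}"
    if *: "directed_set (P\<lparr>carrier := B\<rparr>) S \<and> S \<subseteq> {x \<in> B. x \<sqsubseteq>\<^bsub>P\<^esub> q} \<and>
      is_lub (P\<lparr>carrier := B\<rparr>) s S" for S s
  proof -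
    have "is_lub P s S" using is_lub_directed_closed[OF P B] * by blast
    moreover have "S \<subseteq> carrier P" "\<forall>x\<in>S. x \<sqsubseteq>\<^bsub>P\<^esub> q" using * BP by auto
    moreover have "s \<in> B" using * by (simp add: least_def Upper_def)
    ultimately show ?thesis using is_lub_iff[of S P s] q by simp
  qed
qed auto

text \<open>Generated inductively rather than as an intersection, so that a property of all elements
  can be proved by following how they arise as iterated directed suprema.\<close>

inductive_set directed_closure :: "('a, 'm) gorder_scheme \<Rightarrow> 'a set \<Rightarrow> 'a set"
  for P :: "('a, 'm) gorder_scheme" and X :: "'a set" where
  base: "x \<in> X \<Longrightarrow> x \<in> directed_closure P X"
| lub: "\<lbrakk>\<forall>x\<in>S. x \<in> directed_closure P X; directed_set P S; is_lub P s S\<rbrakk>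
    \<Longrightarrow> s \<in> directed_closure P X"

lemma directed_closed_directed_closure:
  assumes "X \<subseteq> carrier P"
  shows "directed_closed P (directed_closure P X)"
proof -
  have "x \<in> carrier P" if "x \<in> directed_closure P X" for x
    using that by induction (use assms in \<open>auto simp: least_def Upper_def\<close>)
  moreover have "s \<in> directed_closure P X"
    if "S \<subseteq> directed_closure P X" "directed_set P S" "is_lub P s S" for S s
    using that by (intro directed_closure.lub[of S]) auto
  ultimately show ?thesis unfolding directed_closed_def by blast
qed

text \<open>The elements of \<open>P\<close> are the Scott-closed sets of the sub-dcpo \<open>X\<close>, and \<open>X\<close> sits in \<open>P\<close> as
  the principal ideals.\<close>

definition gam_base :: "('a, 'm) gorder_scheme \<Rightarrow> 'a set \<Rightarrow> bool" where
  "gam_base P X \<longleftrightarrow> X \<subseteq> carrier P \<and> dcpo (P\<lparr>carrier := X\<rparr>) \<and>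
    (\<forall>q\<in>carrier P. scott_closed (P\<lparr>carrier := X\<rparr>) {x \<in> X. x \<sqsubseteq>\<^bsub>P\<^esub> q}) \<and>
    (\<forall>C. scott_closed (P\<lparr>carrier := X\<rparr>) C \<longrightarrow> (\<exists>q\<in>carrier P. C = {x \<in> X. x \<sqsubseteq>\<^bsub>P\<^esub> q})) \<and>
    (\<forall>p\<in>carrier P. \<forall>q\<in>carrier P. (\<forall>x\<in>X. x \<sqsubseteq>\<^bsub>P\<^esub> p \<longrightarrow> x \<sqsubseteq>\<^bsub>P\<^esub> q) \<longrightarrow> p \<sqsubseteq>\<^bsub>P\<^esub> q)"

lemma gam_baseD:
  assumes "gam_base P X"
  shows "X \<subseteq> carrier P" "dcpo (P\<lparr>carrier := X\<rparr>)"
    and "q \<in> carrier P \<Longrightarrow> scott_closed (P\<lparr>carrier := X\<rparr>) {x \<in> X. x \<sqsubseteq>\<^bsub>P\<^esub> q}"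
    and "scott_closed (P\<lparr>carrier := X\<rparr>) C \<Longrightarrow> \<exists>q\<in>carrier P. C = {x \<in> X. x \<sqsubseteq>\<^bsub>P\<^esub> q}"
    and "\<lbrakk>p \<in> carrier P; q \<in> carrier P; \<And>x. \<lbrakk>x \<in> X; x \<sqsubseteq>\<^bsub>P\<^esub> p\<rbrakk> \<Longrightarrow> x \<sqsubseteq>\<^bsub>P\<^esub> q\<rbrakk> \<Longrightarrow> p \<sqsubseteq>\<^bsub>P\<^esub> q"
  using assms unfolding gam_base_def by simp_all

text \<open>For \<open>u\<close> in \<open>B\<close>, the elements of \<open>X\<close> below
  \<open>u\<close> form a Scott-closed set of \<open>X\<close>. If it contains a directed set, it
  contains the supremum formed in \<open>X\<close>; so that supremum is least among the upper bounds
  in \<open>B\<close> too.\<close>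

lemma scott_continuous_inclusion:
  assumes P: "partial_order P" and X: "gam_base P X" and B: "X \<subseteq> B" "B \<subseteq> carrier P"
  shows "scott_continuous (P\<lparr>carrier := X\<rparr>) (P\<lparr>carrier := B\<rparr>) (\<lambda>x. x)"
proof (rule scott_continuousI)
  note X = gam_baseD[OF X]
  show "partial_order (P\<lparr>carrier := X\<rparr>)" "partial_order (P\<lparr>carrier := B\<rparr>)"
    using partial_order_subset P X(1) B by blast+
  show "s \<sqsubseteq>\<^bsub>P\<lparr>carrier := B\<rparr>\<^esub> u"
    if *: "directed_set (P\<lparr>carrier := X\<rparr>) S" "is_lub (P\<lparr>carrier := X\<rparr>) s S"
      "u \<in> carrier (P\<lparr>carrier := B\<rparr>)" "\<forall>x\<in>S. x \<sqsubseteq>\<^bsub>P\<lparr>carrier := B\<rparr>\<^esub> u" for S s u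
  proof -
    have "u \<in> carrier P" using *(3) B by auto
    moreover have "S \<subseteq> {x \<in> X. x \<sqsubseteq>\<^bsub>P\<^esub> u}" using *(1,4) by (auto simp: directed_set_def)
    ultimately have "s \<in> {x \<in> X. x \<sqsubseteq>\<^bsub>P\<^esub> u}" using scott_closedD(3)[OF X(3) *(1) _ *(2)] by blast
    then show ?thesis by simp
  qed
qed (use B in auto)

text \<open>Closed sets of \<open>X\<close> and of \<open>B\<close> are compared through
  \<open>P\<close>. A closed set of \<open>X\<close> is the trace of some \<open>q\<close>, and the
  trace of the same \<open>q\<close> on \<open>B\<close> extends it. For \<open>emb\<close>, a
  closed set \<open>W\<close> of \<open>B\<close> is shown to contain every element of
  \<open>B\<close> below the \<open>q\<close> that represents its part in \<open>X\<close>; the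
  elements coming from \<open>Y\<close> are the difficulty.\<close>

lemma gam_base_inclusion_E2:
  assumes P: "dcpo P" and X: "gam_base P X" and Y: "gam_base P Y"
    and B_def: "B = directed_closure P (X \<union> Y)"
  shows "(\<lambda>x\<in>X. x) \<in> E2 (P\<lparr>carrier := X\<rparr>) (P\<lparr>carrier := B\<rparr>)"
proof (rule E2_I)
  note pP = dcpo_partial_order[OF P] note XD = gam_baseD[OF X] note YD = gam_baseD[OF Y]
  interpret P: partial_order P by fact
  have dB: "directed_closed P B"
    unfolding B_def using XD(1) YD(1) by (intro directed_closed_directed_closure) blast
  then have BP: "B \<subseteq> carrier P" by (simp add: directed_closed_def)
  have XB: "X \<subseteq> B" and YB: "Y \<subseteq> B"
    unfolding B_def by (auto intro: directed_closure.base)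
  note inX = scott_continuous_inclusion[OF pP X XB BP]
    and inY = scott_continuous_inclusion[OF pP Y YB BP]
  show "dcpo (P\<lparr>carrier := X\<rparr>)" by (rule XD(2))
  show "dcpo (P\<lparr>carrier := B\<rparr>)" by (rule dcpo_directed_closed[OF P dB])
  show "(\<lambda>x\<in>X. x) \<in> carrier (scott_fun (P\<lparr>carrier := X\<rparr>) (P\<lparr>carrier := B\<rparr>))"
    using XB scott_continuous_cong[OF inX, of "\<lambda>x\<in>X. x"] by (auto simp: scott_fun_def)
  show "\<exists>V. scott_closed (P\<lparr>carrier := B\<rparr>) V \<and>
      C = {x \<in> carrier (P\<lparr>carrier := X\<rparr>). (\<lambda>x\<in>X. x) x \<in> V}"
    if C: "scott_closed (P\<lparr>carrier := X\<rparr>) C" for C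
  proof -
    obtain q where q: "q \<in> carrier P" "C = {x \<in> X. x \<sqsubseteq>\<^bsub>P\<^esub> q}" using XD(4)[OF C] by blast
    have "C = {x \<in> carrier (P\<lparr>carrier := X\<rparr>). (\<lambda>x\<in>X. x) x \<in> {x \<in> B. x \<sqsubseteq>\<^bsub>P\<^esub> q}}"
      using q(2) XB by auto
    then show ?thesis using scott_closed_trace[OF P dB q(1)] by blast
  qed
  show "V \<subseteq> W"
    if V: "scott_closed (P\<lparr>carrier := B\<rparr>) V" and W: "scott_closed (P\<lparr>carrier := B\<rparr>) W"
      and VW: "\<And>x. \<lbrakk>x \<in> carrier (P\<lparr>carrier := X\<rparr>); (\<lambda>x\<in>X. x) x \<in> V\<rbrakk> \<Longrightarrow> (\<lambda>x\<in>X. x) x \<in> W"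
    for V W
  proof
    note VD = scott_closedD[OF V] and WD = scott_closedD[OF W]
    have VB: "V \<subseteq> B" and WB: "W \<subseteq> B" using VD(1) WD(1) by simp_all
    have VWX: "x \<in> W" if "x \<in> X" "x \<in> V" for x using VW[of x] that by simp
    \<comment> \<open>The parts of \<open>W\<close> in \<open>X\<close> and in \<open>Y\<close> are
      closed as preimages under the inclusions, so they are represented by elements \<open>q\<close>
      and \<open>q'\<close> of \<open>P\<close>.\<close>
    obtain q where q: "q \<in> carrier P" "\<And>x. x \<in> X \<Longrightarrow> x \<in> W \<longleftrightarrow> x \<sqsubseteq>\<^bsub>P\<^esub> q"
      using XD(4)[OF scott_closed_vimage[OF inX W]] by auto
    obtain q' where q': "q' \<in> carrier P" "\<And>y. y \<in> Y \<Longrightarrow> y \<in> W \<longleftrightarrow> y \<sqsubseteq>\<^bsub>P\<^esub> q'"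
      using YD(4)[OF scott_closed_vimage[OF inY W]] by auto
    \<comment> \<open>Density is used twice: it suffices to test the \<open>x\<close> in
      \<open>X\<close> below \<open>q\<close>, and for each of them the \<open>y\<close> in
      \<open>Y\<close> below \<open>x\<close>. Such \<open>y\<close> lie in \<open>W\<close> because
      \<open>W\<close> is a lower set of \<open>B\<close>.\<close>
    have "q \<sqsubseteq>\<^bsub>P\<^esub> q'"
    proof (rule XD(5)[OF q(1) q'(1)])
      fix x assume x: "x \<in> X" "x \<sqsubseteq>\<^bsub>P\<^esub> q"
      then have "x \<in> W" using q(2) by simp
      show "x \<sqsubseteq>\<^bsub>P\<^esub> q'"
      proof (rule YD(5)[OF _ q'(1)])
        show "x \<in> carrier P" using x XD(1) by blast
        fix y assume y: "y \<in> Y" "y \<sqsubseteq>\<^bsub>P\<^esub> x"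
        then have "y \<in> W" using WD(2)[of y x] \<open>x \<in> W\<close> YB by auto
        then show "y \<sqsubseteq>\<^bsub>P\<^esub> q'" using q'(2) y by simp
      qed
    qed
    \<comment> \<open>Induction on the generation of \<open>B\<close>. A generator in
      \<open>X\<close> is settled by \<open>q\<close>, one in \<open>Y\<close> by \<open>q'\<close>
      since \<open>q \<sqsubseteq> q'\<close>. If a directed supremum is below \<open>q\<close>, so
      are the members of the directed set; they lie in \<open>W\<close>, which is closed.\<close>
    have below_q: "x \<sqsubseteq>\<^bsub>P\<^esub> q \<longrightarrow> x \<in> W" if "x \<in> B" for x
      using that unfolding B_def
    proof induction
      case (base x)
      have xP: "x \<in> carrier P" using base XD(1) YD(1) by blast
      show ?case
      proof
        assume "x \<sqsubseteq>\<^bsub>P\<^esub> q"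
        then have "x \<sqsubseteq>\<^bsub>P\<^esub> q'" using P.le_trans[OF _ \<open>q \<sqsubseteq>\<^bsub>P\<^esub> q'\<close> xP q(1) q'(1)] by simp
        then show "x \<in> W" using base \<open>x \<sqsubseteq>\<^bsub>P\<^esub> q\<close> q(2)[of x] q'(2)[of x] by blast
      qed
    next
      case (lub S s)
      show ?case
      proof
        assume sq: "s \<sqsubseteq>\<^bsub>P\<^esub> q"
        have SB: "S \<subseteq> B" unfolding B_def using lub by blast
        have SP: "S \<subseteq> carrier P" using SB BP by blast
        have s: "s \<in> carrier P" "\<forall>x\<in>S. x \<sqsubseteq>\<^bsub>P\<^esub> s" using lub(3) unfolding is_lub_iff[OF SP] by simp_all
        have "s \<in> B" using dB SB lub(2,3) unfolding directed_closed_def by blast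
        have "x \<in> W" if "x \<in> S" for x
        proof -
          have "x \<sqsubseteq>\<^bsub>P\<^esub> q" using P.le_trans[of x s q] s sq q(1) that SP by auto
          then show ?thesis using lub(1) that by blast
        qed
        then have "S \<subseteq> W" by blast
        moreover have "directed_set (P\<lparr>carrier := B\<rparr>) S"
          using directed_set_subset_iff[OF BP] SB lub(2) by simp
        ultimately show "s \<in> W"
          using WD(3) is_lub_subset[OF BP SB \<open>s \<in> B\<close> lub(3)] by blast
      qed
    qed
    fix p assume p: "p \<in> V"
    then have "p \<in> B" "p \<in> carrier P" using VB BP by auto
    \<comment> \<open>By density of \<open>X\<close>: what lies in \<open>X\<close> below
      \<open>p\<close> belongs to \<open>V\<close>, hence to \<open>W\<close>, hence is below
      \<open>q\<close>.\<close>
    have "p \<sqsubseteq>\<^bsub>P\<^esub> q"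
    proof (rule XD(5)[OF \<open>p \<in> carrier P\<close> q(1)])
      fix x assume x: "x \<in> X" "x \<sqsubseteq>\<^bsub>P\<^esub> p"
      then have "x \<in> V" using VD(2)[of x p] p XB by auto
      then show "x \<sqsubseteq>\<^bsub>P\<^esub> q" using VWX x q(2) by blast
    qed
    then show "p \<in> W" using below_q \<open>p \<in> B\<close> by blast
  qed
qed

section \<open>The lattice of Scott-closed sets, its principal ideals and its copies\<close>

lemma Gam_simps [simp]:
  "C \<in> carrier (Gam L) \<longleftrightarrow> scott_closed L C" "le (Gam L) = (\<subseteq>)"
  by (simp_all add: Gam_def)

text \<open>The supremum is the least Scott-closed set containing the union; even a directed union
  of Scott-closed sets need not be closed.\<close>

lemma dcpo_Gam: "dcpo (Gam L)"
proof (rule dcpoI)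
  show "partial_order (Gam L)" by (rule partial_orderI) (auto simp: Gam_def)
  fix S
  assume "directed_set (Gam L) S"
  then have Sc: "S \<subseteq> carrier (Gam L)" by (simp add: directed_set_def)
  define I where "I = {C. scott_closed L C \<and> \<Union>S \<subseteq> C}"
  define V where "V = {x \<in> carrier L. \<forall>C\<in>I. x \<in> C}"
  have "scott_closed L V"
    unfolding V_def by (rule scott_closed_INT) (simp add: I_def)
  moreover have "C \<subseteq> V" if "C \<in> S" for C
  proof -
    have "C \<subseteq> carrier L" using subsetD[OF Sc that] scott_closedD(1)[of L C] by simp
    then show ?thesis using that unfolding V_def I_def by blast
  qed
  moreover have "V \<subseteq> C" if "scott_closed L C" "\<forall>C'\<in>S. C' \<subseteq> C" for C
    using that unfolding V_def I_def by blast
  ultimately have "is_lub (Gam L) V S"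
    unfolding is_lub_iff[OF Sc] by simp
  then show "\<exists>V. is_lub (Gam L) V S" by blast
qed

text \<open>Everything follows from \<open>i_le\<close>: the elements of \<open>X\<close> below
  \<open>\<phi> C\<close> are exactly the images under \<open>i\<close> of the points of
  \<open>C\<close>. Thus traces of elements of \<open>P\<close> on \<open>X\<close> correspond to
  closed sets of \<open>D\<close>.\<close>

lemma gam_base_principal:
  assumes D: "dcpo D" and P: "partial_order P" and \<phi>: "order_iso (Gam D) P \<phi>"
    and i_def: "i = (\<lambda>d. \<phi> {x \<in> carrier D. x \<sqsubseteq>\<^bsub>D\<^esub> d})"
    and X_def: "X = i ` carrier D"
  shows "gam_base P X" "order_iso D (P\<lparr>carrier := X\<rparr>) i"
proof -
  interpret D: partial_order D by (rule dcpo_partial_order[OF D])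
  note pD = dcpo_partial_order[OF D]
  have \<phi>_le: "\<phi> C \<sqsubseteq>\<^bsub>P\<^esub> \<phi> C' \<longleftrightarrow> C \<subseteq> C'" if "scott_closed D C" "scott_closed D C'" for C C'
    using order_isoD(2)[OF \<phi>, of C C'] that by simp
  have \<phi>_P: "\<phi> C \<in> carrier P" if "scott_closed D C" for C
    using order_isoD(1)[OF \<phi>, of C] that by simp
  have ex: "\<exists>C. scott_closed D C \<and> p = \<phi> C" if "p \<in> carrier P" for p
    using that order_isoD(4)[OF \<phi>] by (metis Gam_simps(1) imageE)
  \<comment> \<open>A principal ideal is contained in a lower set exactly when its top element
    belongs to it.\<close>
  have i_le: "i d \<sqsubseteq>\<^bsub>P\<^esub> \<phi> C \<longleftrightarrow> d \<in> C" if d: "d \<in> carrier D" and C: "scott_closed D C" for d C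
  proof -
    have "i d \<sqsubseteq>\<^bsub>P\<^esub> \<phi> C \<longleftrightarrow> {x \<in> carrier D. x \<sqsubseteq>\<^bsub>D\<^esub> d} \<subseteq> C"
      unfolding i_def by (rule \<phi>_le[OF scott_closed_principal[OF pD d] C])
    also have "\<dots> \<longleftrightarrow> d \<in> C" using d scott_closedD(2)[OF C] D.le_refl[OF d] by blast
    finally show ?thesis .
  qed
  have i_P: "i d \<in> carrier P" if "d \<in> carrier D" for d
    unfolding i_def by (rule \<phi>_P[OF scott_closed_principal[OF pD that]])
  then have XP: "X \<subseteq> carrier P" by (auto simp: X_def)
  have pX: "partial_order (P\<lparr>carrier := X\<rparr>)" by (rule partial_order_subset[OF P XP])
  show iso: "order_iso D (P\<lparr>carrier := X\<rparr>) i"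
  proof (rule order_isoI[OF pD pX])
    show "i ` carrier D = carrier (P\<lparr>carrier := X\<rparr>)" by (simp add: X_def)
    show "i x \<sqsubseteq>\<^bsub>P\<lparr>carrier := X\<rparr>\<^esub> i y \<longleftrightarrow> x \<sqsubseteq>\<^bsub>D\<^esub> y" if "x \<in> carrier D" "y \<in> carrier D" for x y
      using i_le[OF that(1) scott_closed_principal[OF pD that(2)]] that by (simp add: i_def)
  qed
  note inv = order_iso_inv[OF iso]
  have X_le: "scott_closed (P\<lparr>carrier := X\<rparr>) {x \<in> X. x \<sqsubseteq>\<^bsub>P\<^esub> q}" if "q \<in> carrier P" for q
  proof -
    obtain C where C: "scott_closed D C" "q = \<phi> C" using ex[OF \<open>q \<in> carrier P\<close>] by blast
    let ?j = "inv_into (carrier D) i"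
    \<comment> \<open>The trace of \<open>\<phi> C\<close> on \<open>X\<close> is the preimage of
      \<open>C\<close> under the inverse of \<open>i\<close>.\<close>
    have "?j x \<in> C \<longleftrightarrow> x \<sqsubseteq>\<^bsub>P\<^esub> q" if "x \<in> X" for x
      using i_le[OF _ C(1), of "?j x"] that unfolding X_def C(2)
      by (simp add: inv_into_into f_inv_into_f)
    then have "{x \<in> X. x \<sqsubseteq>\<^bsub>P\<^esub> q} = {x \<in> carrier (P\<lparr>carrier := X\<rparr>). ?j x \<in> C}" by auto
    then show ?thesis
      using scott_closed_vimage[OF order_iso_scott_continuous[OF inv pX pD] C(1)] by simp
  qed
  have X_ex: "\<exists>q\<in>carrier P. C = {x \<in> X. x \<sqsubseteq>\<^bsub>P\<^esub> q}"
    if C: "scott_closed (P\<lparr>carrier := X\<rparr>) C" for C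
  proof
    \<comment> \<open>The closed set is pulled back to \<open>D\<close>; its image under
      \<open>\<phi>\<close> is the representing element.\<close>
    define F where "F = {d \<in> carrier D. i d \<in> C}"
    have F: "scott_closed D F"
      unfolding F_def by (rule scott_closed_vimage[OF order_iso_scott_continuous[OF iso pD pX] C])
    show "\<phi> F \<in> carrier P" by (rule \<phi>_P[OF F])
    have "i d \<in> C \<longleftrightarrow> i d \<sqsubseteq>\<^bsub>P\<^esub> \<phi> F" if "d \<in> carrier D" for d
      using i_le[OF that F] that by (simp add: F_def)
    moreover have "C \<subseteq> X" using scott_closedD(1)[OF C] by simp
    ultimately show "C = {x \<in> X. x \<sqsubseteq>\<^bsub>P\<^esub> \<phi> F}" unfolding X_def by blast
  qed
  have X_dense: "p \<sqsubseteq>\<^bsub>P\<^esub> q"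
    if pq: "p \<in> carrier P" "q \<in> carrier P" "\<forall>x\<in>X. x \<sqsubseteq>\<^bsub>P\<^esub> p \<longrightarrow> x \<sqsubseteq>\<^bsub>P\<^esub> q" for p q
  proof -
    obtain C C' where C: "scott_closed D C" "p = \<phi> C" "scott_closed D C'" "q = \<phi> C'"
      using ex[OF pq(1)] ex[OF pq(2)] by blast
    have "d \<in> C'" if "d \<in> C" for d
    proof -
      have d: "d \<in> carrier D" using scott_closedD(1)[OF C(1)] that by blast
      then have "i d \<in> X" by (simp add: X_def)
      then show ?thesis using pq(3) i_le[OF d C(1)] i_le[OF d C(3)] that C(2,4) by blast
    qed
    then show ?thesis using \<phi>_le C by blast
  qed
  have "dcpo (P\<lparr>carrier := X\<rparr>)" by (rule order_iso_dcpo[OF iso D pX])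
  then show "gam_base P X"
    unfolding gam_base_def using XP X_le X_ex X_dense by blast
qed

text \<open>\<open>R2\<close> tests only dcpos carried by subsets of \<open>'u\<close>, so the
  lattice must be moved there. The order is transported along an injection \<open>j\<close> with
  inverse \<open>k\<close>.\<close>

lemma order_iso_copy:
  fixes L :: "'a gorder"
  assumes L: "partial_order L" and "carrier L \<lesssim> (UNIV :: 'u set)"
  obtains P :: "'u gorder" and \<phi> where "partial_order P" "order_iso L P \<phi>"
proof -
  interpret L: partial_order L by fact
  obtain j :: "'a \<Rightarrow> 'u" where j: "inj_on j (carrier L)"
    using assms(2) unfolding lepoll_def by (elim exE conjE)
  define k where "k = inv_into (carrier L) j"
  have k: "k (j x) = x" if "x \<in> carrier L" for x using that j by (simp add: k_def)
  define P :: "'u gorder" where "P = \<lparr>carrier = j ` carrier L, eq = (=), le = (\<lambda>x y. k x \<sqsubseteq>\<^bsub>L\<^esub> k y)\<rparr>"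
  have P: "carrier P = j ` carrier L" "eq P = (=)" "le P = (\<lambda>x y. k x \<sqsubseteq>\<^bsub>L\<^esub> k y)"
    by (simp_all add: P_def)
  have kP: "k x \<in> carrier L" "j (k x) = x" if x: "x \<in> carrier P" for x
  proof -
    obtain y where y: "x = j y" "y \<in> carrier L" using x unfolding P(1) by (rule imageE)
    then have "k x = y" using k by simp
    then show "k x \<in> carrier L" "j (k x) = x" using y by simp_all
  qed
  have le_P: "x \<sqsubseteq>\<^bsub>P\<^esub> y \<longleftrightarrow> k x \<sqsubseteq>\<^bsub>L\<^esub> k y" for x y
    by (simp add: P(3))
  have trans: "x \<sqsubseteq>\<^bsub>P\<^esub> z"
    if "x \<in> carrier P" "y \<in> carrier P" "z \<in> carrier P" "x \<sqsubseteq>\<^bsub>P\<^esub> y" "y \<sqsubseteq>\<^bsub>P\<^esub> z" for x y z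
    using L.le_trans[of "k x" "k y" "k z"] that(4,5) kP(1) that(1-3) by (simp only: le_P)
  have antisym: "x = y"
    if "x \<in> carrier P" "y \<in> carrier P" "x \<sqsubseteq>\<^bsub>P\<^esub> y" "y \<sqsubseteq>\<^bsub>P\<^esub> x" for x y
  proof -
    have "k x = k y"
      using L.le_antisym[of "k x" "k y"] that(3,4) kP(1) that(1,2) by (simp only: le_P)
    then show ?thesis using kP(2)[OF that(1)] kP(2)[OF that(2)] by metis
  qed
  have "x \<sqsubseteq>\<^bsub>P\<^esub> x" if "x \<in> carrier P" for x
    using L.le_refl[OF kP(1)[OF that]] by (simp only: le_P)
  from partial_orderI[OF P(2) this antisym trans] have "partial_order P" .
  moreover have "order_iso L P j"
    by (rule order_isoI[OF L \<open>partial_order P\<close>]) (simp_all add: P(1,3) k)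
  ultimately show ?thesis by (rule that)
qed

theorem theorem5p5:
  fixes D :: "'a gorder" and E :: "'b gorder"
  assumes "Pow (carrier D) \<lesssim> (UNIV :: 'u set)"
    and "Pow (carrier E) \<lesssim> (UNIV :: 'u set)"
    and "D \<in> R2 TYPE('u)"
    and "E \<in> R2 TYPE('u)"
    and "\<exists>\<phi>. order_iso (Gam D) (Gam E) \<phi>"
  shows "\<exists>f. dcpo_iso D E f"
proof -
  have D: "dcpo D" and E: "dcpo E" using assms(3,4) by (auto simp: R2_def)
  obtain \<theta> where \<theta>: "order_iso (Gam D) (Gam E) \<theta>" using assms(5) by blast
  \<comment> \<open>The elements of the lattice are subsets of \<open>carrier D\<close>, so the
    cardinality assumption on \<open>D\<close> places a copy \<open>P\<close> in \<open>'u\<close>.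
    The dcpos \<open>X\<close>, \<open>Y\<close> and their closure then live in \<open>'u\<close> as
    well.\<close>
  have "carrier (Gam D) \<subseteq> Pow (carrier D)"
  proof
    fix C assume "C \<in> carrier (Gam D)"
    then have "scott_closed D C" by simp
    then show "C \<in> Pow (carrier D)" by (rule PowI[OF scott_closedD(1)])
  qed
  then have "carrier (Gam D) \<lesssim> (UNIV :: 'u set)"
    using assms(1) by (meson lepoll_trans subset_imp_lepoll)
  then obtain P :: "'u gorder" and \<phi> where pP: "partial_order P" and \<phi>: "order_iso (Gam D) P \<phi>"
    using order_iso_copy[OF dcpo_partial_order[OF dcpo_Gam]] by blast
  have P: "dcpo P" by (rule order_iso_dcpo[OF \<phi> dcpo_Gam pP])
  \<comment> \<open>The lattice of \<open>E\<close> is sent to the same \<open>P\<close> through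
    that of \<open>D\<close>, so both dcpos acquire bases in one poset.\<close>
  have \<psi>: "order_iso (Gam E) P (\<phi> \<circ> inv_into (carrier (Gam D)) \<theta>)"
    by (rule order_iso_comp[OF order_iso_inv[OF \<theta>] \<phi>])
  obtain X i where X: "gam_base P X" "order_iso D (P\<lparr>carrier := X\<rparr>) i"
    using gam_base_principal[OF D pP \<phi> refl refl] by blast
  obtain Y k where Y: "gam_base P Y" "order_iso E (P\<lparr>carrier := Y\<rparr>) k"
    using gam_base_principal[OF E pP \<psi> refl refl] by blast
  show ?thesis
  proof (rule R2_iso_if_common_target[OF assms(3,4)])
    show "(\<lambda>x\<in>X. x) \<in> E2 (P\<lparr>carrier := X\<rparr>) (P\<lparr>carrier := directed_closure P (X \<union> Y)\<rparr>)"
      by (rule gam_base_inclusion_E2[OF P X(1) Y(1) refl])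
    \<comment> \<open>The closure of \<open>X \<union> Y\<close> is symmetric, so the same lemma
      applies with \<open>X\<close> and \<open>Y\<close> exchanged.\<close>
    show "(\<lambda>x\<in>Y. x) \<in> E2 (P\<lparr>carrier := Y\<rparr>) (P\<lparr>carrier := directed_closure P (X \<union> Y)\<rparr>)"
      by (rule gam_base_inclusion_E2[OF P Y(1) X(1)]) (simp add: Un_commute)
    show "dcpo_iso D (P\<lparr>carrier := X\<rparr>) i"
      by (rule order_iso_dcpo_iso[OF X(2) D gam_baseD(2)[OF X(1)]])
    show "dcpo_iso E (P\<lparr>carrier := Y\<rparr>) k"
      by (rule order_iso_dcpo_iso[OF Y(2) E gam_baseD(2)[OF Y(1)]])
  qed
qed

end
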